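(* Let $G$ be a connected graph and $\mathcal{B}$ its set of blocks. Then $\dim(\mathrm{CBP}(G))=|\mathcal{B}|$. In particular, $\mathrm{CBP}(G)\subseteq\mathbb{R}^{\mathcal{B}}$ is full-dimensional.
   Context: Graphs are finite, simple and undirected. A connected graph is 2-connected if it has at least three vertices and remains connected after deleting any single vertex. A bridge is an edge whose deletion increases the number of connected components. A block of $G$ is a maximal 2-connected subgraph of $G$ or a bridge together with its two end vertices; $\mathcal{B}$ denotes the set of blocks of $G$. For $\mathcal{A}\subseteq\mathcal{B}$ let $G[\mathcal{A}]=\bigcup_{B\in\mathcal{A}}B$ (the empty graph counts as connected), and let $\chi^{\mathcal{A}}\in\{0,1\}^{\mathcal{B}}$ be the incidence vector of $\mathcal{A}$. The connected blocks polytope is $\mathrm{CBP}(G)=\mathrm{conv}\{\chi^{\mathcal{A}}\mid \mathcal{A}\subseteq\mathcal{B},\ G[\mathcal{A}]\text{ connected}\}\subseteq\mathbb{R}^{\mathcal{B}}$. *)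

theory Defs
  imports "HOL-Analysis.Analysis"
begin

text \<open>
  Graphs are pairs of a vertex set and an edge set, an edge being a two-element set of vertices.
  Vertices come from a finite type \<open>'v\<close> (the vertex set may be any subset of it), so that
  \<open>'v graph\<close> is itself a finite type and can index the coordinates of a Euclidean space.
\<close>

type_synonym 'v graph = "'v set \<times> 'v set set"

abbreviation verts :: "'v graph \<Rightarrow> 'v set" where "verts \<equiv> fst"
abbreviation edges :: "'v graph \<Rightarrow> 'v set set" where "edges \<equiv> snd"

definition simple_graph :: "'v graph \<Rightarrow> bool" where
  "simple_graph G \<longleftrightarrow> finite (verts G) \<and> (\<forall>e\<in>edges G. e \<subseteq> verts G \<and> card e = 2)"

definition subgraph :: "'v graph \<Rightarrow> 'v graph \<Rightarrow> bool" where
  "subgraph H G \<longleftrightarrow> simple_graph H \<and> verts H \<subseteq> verts G \<and> edges H \<subseteq> edges G"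

definition connection :: "'v graph \<Rightarrow> ('v \<times> 'v) set" where
  "connection G = {(u, v). {u, v} \<in> edges G}\<^sup>* \<inter> verts G \<times> verts G"

text \<open>The empty graph is connected under this definition.\<close>

definition connected_graph :: "'v graph \<Rightarrow> bool" where
  "connected_graph G \<longleftrightarrow> (\<forall>u\<in>verts G. \<forall>v\<in>verts G. (u, v) \<in> connection G)"

definition components :: "'v graph \<Rightarrow> 'v set set" where
  "components G = verts G // connection G"

definition delete_vertex :: "'v graph \<Rightarrow> 'v \<Rightarrow> 'v graph" where
  "delete_vertex G v = (verts G - {v}, {e \<in> edges G. v \<notin> e})"

definition delete_edge :: "'v graph \<Rightarrow> 'v set \<Rightarrow> 'v graph" where
  "delete_edge G e = (verts G, edges G - {e})"

definition two_connected :: "'v graph \<Rightarrow> bool" where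
  "two_connected G \<longleftrightarrow> connected_graph G \<and> card (verts G) \<ge> 3 \<and>
     (\<forall>v\<in>verts G. connected_graph (delete_vertex G v))"

definition bridge :: "'v graph \<Rightarrow> 'v set \<Rightarrow> bool" where
  "bridge G e \<longleftrightarrow> e \<in> edges G \<and> card (components (delete_edge G e)) > card (components G)"

definition maximal_two_connected :: "'v graph \<Rightarrow> 'v graph \<Rightarrow> bool" where
  "maximal_two_connected G B \<longleftrightarrow> subgraph B G \<and> two_connected B \<and>
     (\<forall>H. subgraph H G \<and> two_connected H \<and> subgraph B H \<longrightarrow> H = B)"

text \<open>A bridge \<open>e = {u, v}\<close> with its end vertices is the graph \<open>({u, v}, {{u, v}}) = (e, {e})\<close>.\<close>

definition blocks :: "'v graph \<Rightarrow> 'v graph set" where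
  "blocks G = {B. maximal_two_connected G B} \<union> {(e, {e}) | e. bridge G e}"

definition graph_Union :: "'v graph set \<Rightarrow> 'v graph" where
  "graph_Union A = (\<Union>B\<in>A. verts B, \<Union>B\<in>A. edges B)"

text \<open>
  The space of real vectors indexed by the blocks of \<open>G\<close>, realised as a coordinate subspace: a
  coordinate \<open>x $ H\<close> whose index \<open>H\<close> is not a block is zero. If \<open>G\<close> has no blocks, this is the
  zero space.
\<close>

definition block_space :: "'v::finite graph \<Rightarrow> (real ^ ('v graph)) set" where
  "block_space G = {x. \<forall>H. H \<notin> blocks G \<longrightarrow> x $ H = 0}"

definition incidence_vector :: "'v::finite graph set \<Rightarrow> real ^ ('v graph)" where
  "incidence_vector A = (\<chi> B. if B \<in> A then 1 else 0)"

definition CBP :: "'v::finite graph \<Rightarrow> (real ^ ('v graph)) set" where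
  "CBP G = convex hull {incidence_vector A | A. A \<subseteq> blocks G \<and> connected_graph (graph_Union A)}"

end

theory Submission
  imports Defs
begin

text \<open>The empty set of blocks and each single block induce connected subgraphs, so the
  polytope contains the origin and the unit vector \<open>axis B 1\<close> of every block
  \<open>B\<close> (\<open>zero_in_CBP\<close>, \<open>axis_in_CBP\<close>). These unit vectors span
  \<open>block_space G\<close>, which in turn contains the polytope; hence \<open>span_CBP\<close>.
  Since the origin belongs to the polytope, its affine dimension is the linear dimension of this
  span, the number of blocks (\<open>dim_block_space\<close>).\<close>

lemma connected_graph_single_edge:
  assumes "card e = 2"
  shows "connected_graph (e, {e})"
proof -
  obtain a b where e: "e = {a, b}"
    using assms by (meson card_2_iff)
  have "(u, v) \<in> {(u, v). {u, v} \<in> {e}}\<^sup>*" if "u \<in> e" "v \<in> e" for u v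
    \<comment> \<open>For \<open>u = v\<close> the set \<open>{u, v}\<close> is no edge and
      reflexivity of the closure is needed; otherwise \<open>{u, v} = e\<close> is a single
      step.\<close>
    using that e by (cases "u = v") (auto intro!: r_into_rtrancl)
  then show ?thesis
    by (auto simp: connected_graph_def connection_def)
qed

text \<open>2-connectedness includes connectedness, and a bridge of a simple graph has two distinct
  ends.\<close>

lemma connected_block:
  assumes "simple_graph G" and "B \<in> blocks G"
  shows "connected_graph B"
  using assms connected_graph_single_edge
  by (auto simp: blocks_def maximal_two_connected_def two_connected_def bridge_def simple_graph_def)

lemma incidence_vector_empty: "incidence_vector {} = 0"
  by (simp add: incidence_vector_def vec_eq_iff)

lemma incidence_vector_singleton: "incidence_vector {B} = axis B 1"
  by (simp add: incidence_vector_def axis_def vec_eq_iff)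

lemma axes_subset_Basis: "(\<lambda>B. axis B (1::real)) ` S \<subseteq> Basis"
  by (auto simp: axis_in_Basis_iff)

text \<open>A span of standard basis vectors is cut out by the vanishing of the remaining
  coordinates. In this form, \<open>block_space G\<close> is visibly a subspace with a known
  basis.\<close>

lemma block_space_eq_span: "block_space G = span ((\<lambda>B. axis B 1) ` blocks G)"
  by (subst span_substd_basis[OF axes_subset_Basis])
    (auto simp: block_space_def Basis_vec_def inner_axis axis_eq_axis image_iff)

lemma dim_block_space: "dim (block_space G) = card (blocks G)"
proof -
  have "independent ((\<lambda>B. axis B (1::real)) ` blocks G)"
    using independent_Basis axes_subset_Basis independent_mono by blast
  then show ?thesis
    \<comment> \<open>Distinct blocks have distinct unit vectors, so the basis has as many elements
      as there are blocks.\<close>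
    by (simp add: block_space_eq_span dim_eq_card_independent card_image inj_on_def axis_eq_axis)
qed

lemma CBP_subset_block_space: "CBP G \<subseteq> block_space G"
  unfolding CBP_def
proof (rule hull_minimal)
  show "{incidence_vector A |A. A \<subseteq> blocks G \<and> connected_graph (graph_Union A)} \<subseteq> block_space G"
    by (auto simp: block_space_def incidence_vector_def)
  show "convex (block_space G)"
    by (simp add: block_space_eq_span subspace_imp_convex)
qed

lemma zero_in_CBP: "0 \<in> CBP G"
  unfolding CBP_def
  by (intro hull_inc CollectI exI[of _ "{}"])
    (simp add: incidence_vector_empty graph_Union_def connected_graph_def)

lemma axis_in_CBP:
  assumes "simple_graph G" and "B \<in> blocks G"
  shows "axis B 1 \<in> CBP G"
  unfolding CBP_def
  by (intro hull_inc CollectI exI[of _ "{B}"])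
    (simp add: incidence_vector_singleton graph_Union_def connected_block[OF assms] assms(2))

lemma span_CBP:
  assumes "simple_graph G"
  shows "span (CBP G) = block_space G"
proof
  show "span (CBP G) \<subseteq> block_space G"
    using CBP_subset_block_space by (metis block_space_eq_span span_minimal subspace_span)
  show "block_space G \<subseteq> span (CBP G)"
    unfolding block_space_eq_span using axis_in_CBP[OF assms] by (intro span_mono) auto
qed

theorem proposition4p1:
  fixes G :: "'v::finite graph"
  assumes "simple_graph G" and "connected_graph G"
  shows "aff_dim (CBP G) = int (card (blocks G))
    \<and> CBP G \<subseteq> block_space G
    \<and> aff_dim (CBP G) = int (dim (block_space G))"
proof -
  have "aff_dim (CBP G) = int (dim (CBP G))"
    \<comment> \<open>An affine hull through the origin is a linear span.\<close>
    by (simp add: aff_dim_zero hull_inc zero_in_CBP)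
  also have "\<dots> = int (dim (block_space G))"
    by (metis dim_span span_CBP[OF assms(1)])
  finally show ?thesis
    using CBP_subset_block_space dim_block_space by metis
qed

end
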